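(* For all time series $S$ and $T$ over $\mathbb R^k$, $d^\Delta_1(S,T)\le(\min\{\#S,\#T\}-1)\cdot d^C_1(S,T)$.
   Context: A time series over $\mathbb R^k$ is a finite sequence $T=(t_0,\dots,t_{n-1})$ of vectors in $\mathbb R^k$, with length $\#T=n$; $T_b^\ell=(t_b,\dots,t_{b+\ell-1})$. For equal-length $S,T$, $d_1(S,T)=\sum_i\|s_i-t_i\|_2$; if $\#S=m\le n=\#T$, $d_1(S,T)=d_1(T,S)=\min_{b\in[0,n-m]}d_1(S,T_b^m)$. $d_1^C(S,T)=\inf_{M,v}d_1(S,M\cdot T+v)$ over real orthogonal $k\times k$ matrices $M$ and $v\in\mathbb R^k$, where $M\cdot T+v=(Mt_i+v)_i$. The structure of $T$ is $\Delta T=(\|t_i-t_{i+j}\|_2)_{i\in[0,n-1),j\in[1,n-i)}$. For equal-length $S,T$, $d^\Delta_1(S,T)=\sum_{i,j}|(\Delta S)_{i,j}-(\Delta T)_{i,j}|$; for $\#S=m\le n=\#T$, $d^\Delta_1(S,T)=d^\Delta_1(T,S)=\min_{b\in[0,n-m]}d^\Delta_1(S,T_b^m)$. *)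

theory Defs
  imports "HOL-Analysis.Analysis"
begin

type_synonym 'k time_series = "(real ^ 'k) list"

definition window :: "'k::finite time_series \<Rightarrow> nat \<Rightarrow> nat \<Rightarrow> 'k time_series" where
  "window T b l = take l (drop b T)"

text \<open>The distances are first given on series of equal length (the suffix \<open>_eq\<close>), and then
  extended by sliding the shorter series along the longer one.\<close>

definition d1_eq :: "'k::finite time_series \<Rightarrow> 'k time_series \<Rightarrow> real" where
  "d1_eq S T = (\<Sum>i<length S. norm (S ! i - T ! i))"

definition sliding_min ::
    "('k::finite time_series \<Rightarrow> 'k time_series \<Rightarrow> real) \<Rightarrow> 'k time_series \<Rightarrow> 'k time_series \<Rightarrow> real" where
  "sliding_min d S T = Min ((\<lambda>b. d S (window T b (length S))) ` {0..length T - length S})"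

definition d1 :: "'k::finite time_series \<Rightarrow> 'k time_series \<Rightarrow> real" where
  "d1 S T = (if length S \<le> length T then sliding_min d1_eq S T else sliding_min d1_eq T S)"

definition transform ::
    "real ^ 'k ^ 'k \<Rightarrow> real ^ 'k \<Rightarrow> 'k::finite time_series \<Rightarrow> 'k time_series" where
  "transform M v T = map (\<lambda>t. M *v t + v) T"

definition d1_C :: "'k::finite time_series \<Rightarrow> 'k time_series \<Rightarrow> real" where
  "d1_C S T = (INF (M, v) \<in> {M. orthogonal_matrix M} \<times> UNIV. d1 S (transform M v T))"

text \<open>The second index of the structure is an offset: the entry at \<open>(i, j)\<close> compares
  positions \<open>i\<close> and \<open>i + j\<close>.\<close>

definition structure_entry :: "'k::finite time_series \<Rightarrow> nat \<Rightarrow> nat \<Rightarrow> real" where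
  "structure_entry T i j = norm (T ! i - T ! (i + j))"

definition d1_Delta_eq :: "'k::finite time_series \<Rightarrow> 'k time_series \<Rightarrow> real" where
  "d1_Delta_eq S T =
    (\<Sum>i\<in>{0..<length S - 1}. \<Sum>j\<in>{1..<length S - i}. \<bar>structure_entry S i j - structure_entry T i j\<bar>)"

definition d1_Delta :: "'k::finite time_series \<Rightarrow> 'k time_series \<Rightarrow> real" where
  "d1_Delta S T =
    (if length S \<le> length T then sliding_min d1_Delta_eq S T else sliding_min d1_Delta_eq T S)"

lemma d1_equal_length: "length S = length T \<Longrightarrow> d1 S T = d1_eq S T"
  by (simp add: d1_def sliding_min_def window_def)

lemma d1_Delta_equal_length: "length S = length T \<Longrightarrow> d1_Delta S T = d1_Delta_eq S T"
  by (simp add: d1_Delta_def sliding_min_def window_def)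

lemma d1_eq_commute: "length S = length T \<Longrightarrow> d1_eq S T = d1_eq T S"
  by (simp add: d1_eq_def norm_minus_commute)

lemma d1_Delta_eq_commute: "length S = length T \<Longrightarrow> d1_Delta_eq S T = d1_Delta_eq T S"
  by (simp add: d1_Delta_eq_def abs_minus_commute)

lemma d1_commute: "d1 S T = d1 T S"
  by (cases "length S = length T") (simp_all add: d1_equal_length d1_eq_commute, simp add: d1_def)

lemma d1_Delta_commute: "d1_Delta S T = d1_Delta T S"
  by (cases "length S = length T")
     (simp_all add: d1_Delta_equal_length d1_Delta_eq_commute, simp add: d1_Delta_def)

end

theory Submission
  imports Defs
begin

text \<open>The structure is invariant under \<open>t \<mapsto> M t + v\<close> with \<open>M\<close> orthogonal, so it suffices to bound
  the structure distance by \<open>d1\<close>, and after choosing the best window the two series may be assumed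
  to have equal length \<open>n\<close>. The triangle inequality bounds the contribution of each pair of
  positions by the sum of the two pointwise errors, and each position lies in \<open>n - 1\<close> pairs.\<close>

text \<open>Induction on \<open>n\<close>: the new position \<open>n\<close> forms one new pair with
  each \<open>i < n\<close>, at offset \<open>n - i\<close>, and this adds \<open>e i + e n\<close>.
  The new row \<open>i = n\<close> is empty.\<close>

lemma sum_pairs_add:
  fixes e :: "nat \<Rightarrow> real"
  shows "(\<Sum>i<n. \<Sum>j\<in>{1..<n - i}. e i + e (i + j)) = (real n - 1) * (\<Sum>i<n. e i)"
proof (induction n)
  case 0
  then show ?case by simp
next
  case (Suc n)
  have "(\<Sum>j\<in>{1..<Suc n - i}. e i + e (i + j)) =
      (\<Sum>j\<in>{1..<n - i}. e i + e (i + j)) + (e i + e n)" if "i < n" for i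
  proof -
    have "{1..<Suc n - i} = insert (n - i) {1..<n - i}"
      using that by auto
    then show ?thesis
      using that by (simp add: add.commute)
  qed
  then have "(\<Sum>i<Suc n. \<Sum>j\<in>{1..<Suc n - i}. e i + e (i + j)) =
      (\<Sum>i<n. (\<Sum>j\<in>{1..<n - i}. e i + e (i + j)) + (e i + e n))"
    by simp
  also have "\<dots> = (real n - 1) * (\<Sum>i<n. e i) + ((\<Sum>i<n. e i) + real n * e n)"
    by (subst sum.distrib, subst Suc.IH) (simp add: sum.distrib)
  also have "\<dots> = (real (Suc n) - 1) * (\<Sum>i<Suc n. e i)"
    by (simp add: algebra_simps)
  finally show ?case .
qed

lemma abs_structure_entry_diff_le:
  "\<bar>structure_entry S i j - structure_entry T i j\<bar>
    \<le> norm (S ! i - T ! i) + norm (S ! (i + j) - T ! (i + j))"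
  unfolding structure_entry_def by norm

lemma d1_Delta_eq_le_d1_eq: "d1_Delta_eq S T \<le> (real (length S) - 1) * d1_eq S T"
proof -
  let ?n = "length S"
  let ?e = "\<lambda>i. norm (S ! i - T ! i)"
  have "d1_Delta_eq S T \<le> (\<Sum>i\<in>{0..<?n - 1}. \<Sum>j\<in>{1..<?n - i}. ?e i + ?e (i + j))"
    unfolding d1_Delta_eq_def by (intro sum_mono abs_structure_entry_diff_le)
  \<comment> \<open>The extra row \<open>i = ?n - 1\<close> has the empty offset range
    \<open>{1..<1}\<close>.\<close>
  also have "\<dots> = (\<Sum>i<?n. \<Sum>j\<in>{1..<?n - i}. ?e i + ?e (i + j))"
    by (rule sum.mono_neutral_left) auto
  also have "\<dots> = (real ?n - 1) * d1_eq S T"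
    unfolding d1_eq_def by (rule sum_pairs_add)
  finally show ?thesis .
qed

text \<open>A window that is optimal for \<open>d'\<close> is also a candidate for \<open>d\<close>.
  The argument allows negative \<open>c\<close>, and the factor is indeed -1 when the shorter series
  is empty.\<close>

lemma sliding_min_le_mult_sliding_min:
  assumes "\<And>U. d S U \<le> c * d' S U"
  shows "sliding_min d S T \<le> c * sliding_min d' S T"
proof -
  have "sliding_min d' S T \<in> (\<lambda>b. d' S (window T b (length S))) ` {0..length T - length S}"
    unfolding sliding_min_def by (rule Min_in) auto
  then obtain b where "b \<in> {0..length T - length S}"
    and min: "sliding_min d' S T = d' S (window T b (length S))"
    by blast
  then have "sliding_min d S T \<le> d S (window T b (length S))"
    unfolding sliding_min_def by (intro Min_le) auto
  also have "\<dots> \<le> c * sliding_min d' S T"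
    unfolding min by (rule assms)
  finally show ?thesis .
qed

lemma d1_Delta_le_d1: "d1_Delta S T \<le> (real (min (length S) (length T)) - 1) * d1 S T"
  unfolding d1_Delta_def d1_def
  by (auto simp: min_def intro!: sliding_min_le_mult_sliding_min d1_Delta_eq_le_d1_eq)

text \<open>The translation cancels in the difference, and orthogonal maps preserve the norm. The
  index bound keeps both positions inside the list, where \<open>!\<close> commutes with
  \<open>map\<close>.\<close>

lemma structure_entry_transform:
  assumes "orthogonal_matrix M" "i + j < length T"
  shows "structure_entry (transform M v T) i j = structure_entry T i j"
proof -
  have "norm (M *v x) = norm x" for x
    using assms(1) orthogonal_transformation_matrix [of "(*v) M"]
    by (simp add: orthogonal_transformation)
  then show ?thesis
    using assms(2)
    by (simp add: structure_entry_def transform_def flip: matrix_vector_mult_diff_distrib)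
qed

text \<open>The index ranges come from the first argument \<open>S\<close>, so its length must not
  exceed that of the transformed series.\<close>

lemma d1_Delta_eq_transform_right:
  assumes "orthogonal_matrix M" "length S \<le> length T"
  shows "d1_Delta_eq S (transform M v T) = d1_Delta_eq S T"
  unfolding d1_Delta_eq_def
  by (intro sum.cong refl) (use assms in \<open>auto simp: structure_entry_transform\<close>)

lemma d1_Delta_eq_transform_left:
  assumes "orthogonal_matrix M"
  shows "d1_Delta_eq (transform M v S) T = d1_Delta_eq S T"
proof -
  have "length (transform M v S) = length S"
    by (simp add: transform_def)
  then show ?thesis
    unfolding d1_Delta_eq_def
    by (intro sum.cong) (use assms in \<open>auto simp: structure_entry_transform\<close>)
qed

lemma d1_Delta_transform:
  assumes "orthogonal_matrix M"
  shows "d1_Delta S (transform M v T) = d1_Delta S T"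
proof -
  have len: "length (transform M v T) = length T"
    by (simp add: transform_def)
  have win: "window (transform M v T) b l = transform M v (window T b l)" for b l
    by (simp add: window_def transform_def take_map drop_map)
  show ?thesis
  proof (cases "length S \<le> length T")
    case True
    \<comment> \<open>For these \<open>b\<close> the window is not truncated and has exactly the
      length of \<open>S\<close>.\<close>
    then have "d1_Delta_eq S (window (transform M v T) b (length S)) =
        d1_Delta_eq S (window T b (length S))" if "b \<in> {0..length T - length S}" for b
      unfolding win using that
      by (intro d1_Delta_eq_transform_right assms) (auto simp: window_def)
    then show ?thesis
      using True unfolding d1_Delta_def sliding_min_def len
      by (simp cong: image_cong_simp)
  next
    case False
    then show ?thesis
      by (simp add: d1_Delta_def sliding_min_def len d1_Delta_eq_transform_left assms)
  qed
qed

theorem theorem5: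
  fixes S T :: "'k::finite time_series"
  shows "d1_Delta S T \<le> (real (min (length S) (length T)) - 1) * d1_C S T"
proof -
  let ?m = "min (length S) (length T)"
  let ?A = "{M :: real ^ 'k ^ 'k. orthogonal_matrix M} \<times> (UNIV :: (real ^ 'k) set)"
  have nonempty: "?A \<noteq> {}"
    using orthogonal_matrix_id by blast
  have bound: "d1_Delta S T \<le> (real ?m - 1) * d1 S (transform M v T)" if "orthogonal_matrix M" for M v
    using d1_Delta_le_d1 [of S "transform M v T"] d1_Delta_transform [OF that]
    by (simp add: transform_def)
  \<comment> \<open>Moving the bound inside the infimum means dividing by \<open>?m - 1\<close>,
    which must be positive. For \<open>?m = 0\<close> the factor is -1, but every value under the
    infimum is 0; for \<open>?m = 1\<close> the factor vanishes.\<close>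
  consider "?m = 0" | "?m = 1" | "?m > 1"
    by linarith
  then show ?thesis
  proof cases
    case 1
    then have zero: "d1 S (transform M v T) = 0" for M v
      by (auto simp: min_def d1_def sliding_min_def d1_eq_def transform_def image_constant_conv
          split: if_splits)
    then have "d1_C S T = 0"
      using nonempty by (simp add: d1_C_def case_prod_beta)
    moreover have "d1_Delta S T \<le> 0"
      using bound [OF orthogonal_matrix_id] by (simp add: zero)
    ultimately show ?thesis
      by simp
  next
    case 2
    then show ?thesis
      using bound [OF orthogonal_matrix_id] by simp
  next
    case 3
    \<comment> \<open>By \<open>bound\<close>, the quotient is a lower bound for all values under
      the infimum.\<close>
    then have "d1_Delta S T / (real ?m - 1) \<le> d1_C S T"
      unfolding d1_C_def using bound
      by (intro cINF_greatest nonempty) (auto simp: divide_le_eq mult.commute)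
    then show ?thesis
      using 3 by (simp add: divide_le_eq mult.commute)
  qed
qed

end
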